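(* For every integer $n\ge 2$, the order $n$ stealth configuration $S_n$ in standard position can be decomposed into the disjoint union of the following five smaller stealth configurations: (i) an order $n-1$ stealth configuration growing down from $[1,0]$ (the nose); (ii) an order $n-1$ stealth configuration growing to the right from $[2^n,-(2^n-1)]$ (the left wing); (iii) an order $n-1$ stealth configuration growing to the left from $[2^n,2^n-1]$ (the right wing); (iv) an order $n-2$ stealth configuration growing down from $[2^n-2^{n-2}+1,0]$ (the main body); and (v) an order $n-2$ stealth configuration growing up from $[2^n+2^{n-1}-1,0]$ (the tail). Here "decomposed into the disjoint union" means: the cell sets of the five placed configurations are pairwise disjoint and contained in the cell set of $S_n$, on each of them the contents of $S_n$ agree with the contents of the placed configuration, and every cell of $S_n$ lying in none of the five contains $0$ (so the set of cells of $S_n$ containing $1$ is the disjoint union of the sets of cells containing $1$ in the five pieces).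
   Context: The Pascal rhombus is the array of integers $R[n,k]$ ($n\ge 0$ an integer row index, $k\in\mathbb{Z}$ a column index) defined by $R[0,j]=0$ for all $j$, $R[1,0]=1$, $R[1,j]=0$ for $j\neq 0$, and $R[n,k]=R[n-1,k-1]+R[n-1,k]+R[n-1,k+1]+R[n-2,k]$ for $n\ge 2$ and all $k$. The notation $[n,k]$ denotes the cell in row $n$, column $k$; rows are numbered downward and columns to the right. The Pascal rhombus (mod 2) is the array of entries reduced modulo 2. For $n\ge 2$, the order $n$ stealth configuration $S_n$ (in standard position) is the part of the Pascal rhombus (mod 2) (cells together with their contents) strictly within the octagon whose consecutive vertices are the cells $[0,0]$, $[2^n,-2^n]$, $[2^n+2^{n-1},-2^{n-1}]$, $[2^n+2^{n-2},-2^{n-2}]$, $[2^n+2^{n-1},0]$, $[2^n+2^{n-2},2^{n-2}]$, $[2^n+2^{n-1},2^{n-1}]$, $[2^n,2^n]$, and back to $[0,0]$. $S_1$ consists of the cells $[1,0],[2,-1],[2,0],[2,1]$ of the Pascal rhombus (mod 2), and $S_0$ consists of the single cell $[1,0]$. Translations and rotations of stealth configurations are also called stealth configurations. The order $m$ stealth configuration growing down, right, left, or up from the cell $[a,b]$ is the image of $S_m$ (cells with contents) under the map sending the cell $[1+i,j]$ to $[a+i,b+j]$, $[a-j,b+i]$, $[a+j,b-i]$, or $[a-i,b-j]$, respectively. *)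

theory Defs
  imports "HOL-Analysis.Analysis"
begin

fun R :: "nat \<Rightarrow> int \<Rightarrow> int" where
  "R 0 k = 0"
| "R (Suc 0) k = (if k = 0 then 1 else 0)"
| "R (Suc (Suc n)) k = R (Suc n) (k - 1) + R (Suc n) k + R (Suc n) (k + 1) + R n k"

text \<open>
  A cell is a pair (row, column), with rows numbered downward. Row numbers are integers, so
  that cells can be translated and rotated freely. A configuration is a set of cells together
  with their contents, given as a set of pairs (cell, content).
\<close>

type_synonym cell = "int \<times> int"
type_synonym configuration = "(cell \<times> int) set"

definition cells :: "configuration \<Rightarrow> cell set" where
  "cells C = fst ` C"

definition rhombus_mod2 :: configuration where
  "rhombus_mod2 = {((int i, j), R i j mod 2) | i j. True}"

definition polygon_boundary :: "(real \<times> real) list \<Rightarrow> (real \<times> real) set" where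
  "polygon_boundary vs = (\<Union>(p, q)\<in>set (zip vs (rotate1 vs)). closed_segment p q)"

text \<open>The octagon is not convex. The exponents are natural numbers, so it is meant for \<open>n \<ge> 2\<close>.\<close>

definition octagon :: "nat \<Rightarrow> (real \<times> real) list" where
  "octagon n =
    [(0, 0),
     (2 ^ n, - (2 ^ n)),
     (2 ^ n + 2 ^ (n - 1), - (2 ^ (n - 1))),
     (2 ^ n + 2 ^ (n - 2), - (2 ^ (n - 2))),
     (2 ^ n + 2 ^ (n - 1), 0),
     (2 ^ n + 2 ^ (n - 2), 2 ^ (n - 2)),
     (2 ^ n + 2 ^ (n - 1), 2 ^ (n - 1)),
     (2 ^ n, 2 ^ n)]"

text \<open>
  The library's \<open>inside B\<close> consists of the points off \<open>B\<close> whose connected component in the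
  complement of \<open>B\<close> is bounded; for the boundary of a simple polygon this is its open interior.
\<close>

definition stealth_region :: "nat \<Rightarrow> cell set" where
  "stealth_region n =
    (if n = 0 then {(1, 0)}
     else if n = 1 then {(1, 0), (2, -1), (2, 0), (2, 1)}
     else {(i, j). (real_of_int i, real_of_int j) \<in> inside (polygon_boundary (octagon n))})"

definition stealth :: "nat \<Rightarrow> configuration" where
  "stealth n = {(c, v) \<in> rhombus_mod2. c \<in> stealth_region n}"

definition grow_down :: "nat \<Rightarrow> cell \<Rightarrow> configuration" where
  "grow_down m = (\<lambda>(a, b). {((a + i, b + j), v) | i j v. ((1 + i, j), v) \<in> stealth m})"

definition grow_right :: "nat \<Rightarrow> cell \<Rightarrow> configuration" where
  "grow_right m = (\<lambda>(a, b). {((a - j, b + i), v) | i j v. ((1 + i, j), v) \<in> stealth m})"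

definition grow_left :: "nat \<Rightarrow> cell \<Rightarrow> configuration" where
  "grow_left m = (\<lambda>(a, b). {((a + j, b - i), v) | i j v. ((1 + i, j), v) \<in> stealth m})"

definition grow_up :: "nat \<Rightarrow> cell \<Rightarrow> configuration" where
  "grow_up m = (\<lambda>(a, b). {((a - i, b - j), v) | i j v. ((1 + i, j), v) \<in> stealth m})"

text \<open>
  Since configurations are sets of (cell, content) pairs, \<open>P \<subseteq> S\<close> says both that the cells of \<open>P\<close>
  are cells of \<open>S\<close> and that the contents agree there. The pieces need not cover all cells of \<open>S\<close>,
  but the cells left over must contain 0.
\<close>

definition decomposes_into :: "configuration \<Rightarrow> configuration list \<Rightarrow> bool" where
  "decomposes_into S Ps \<longleftrightarrow>
    disjoint_family_on (\<lambda>i. cells (Ps ! i)) {..<length Ps} \<and>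
    (\<forall>P\<in>set Ps. P \<subseteq> S) \<and>
    (\<forall>(c, v)\<in>S. (\<forall>P\<in>set Ps. c \<notin> cells P) \<longrightarrow> v = 0)"

end

theory Submission
  imports Defs
begin

text \<open>
  Modulo 2, the recursion says that the five cells of every plus-shaped neighbourhood sum to 0
  (except around \<open>(0, 0)\<close>), a rule that is invariant under rotations. For a stealth configuration
  of order at least 1, extended by 0, the plus-shaped sums are odd exactly at the six
  convex vertices of its octagon. When the five pieces are overlaid, their vertices cancel in pairs except
  for the six convex ones of the big octagon; since a configuration supported in the octagon is
  determined by its plus-shaped sums row by row, the overlay is the big stealth configuration.
\<close>

section \<open>The interior of the octagon as a system of inequalities\<close>

text \<open>With \<open>K = 2 ^ n\<close> this is the open octagon, and the description also fits the exceptional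
  orders 0 and 1.\<close>

definition silhouette :: "'a::linordered_idom \<Rightarrow> 'a \<Rightarrow> 'a \<Rightarrow> bool" where
  "silhouette K x y \<longleftrightarrow>
     \<bar>y\<bar> < x \<and> x + \<bar>y\<bar> < 2 * K \<and> (x - \<bar>y\<bar> < K \<or> 2 * (x + \<bar>y\<bar>) < 3 * K)"

text \<open>The last disjunction cuts out the two notches beside the tail; where both of its
  inequalities are equalities lie the two reflex vertices.\<close>

definition closed_silhouette :: "'a::linordered_idom \<Rightarrow> 'a \<Rightarrow> 'a \<Rightarrow> bool" where
  "closed_silhouette K x y \<longleftrightarrow>
     \<bar>y\<bar> \<le> x \<and> x + \<bar>y\<bar> \<le> 2 * K \<and> (x - \<bar>y\<bar> \<le> K \<or> 2 * (x + \<bar>y\<bar>) \<le> 3 * K)"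

text \<open>Every edge of the octagon is diagonal or antidiagonal, so lying on it amounts to one
  linear equation and an interval for \<open>x\<close>.\<close>

lemma mem_closed_segment_diagonal:
  fixes a b c d x y :: real
  assumes "c - a = d - b"
  shows "(x, y) \<in> closed_segment (a, b) (c, d) \<longleftrightarrow> x - a = y - b \<and> x \<in> closed_segment a c"
proof
  assume "(x, y) \<in> closed_segment (a, b) (c, d)"
  then obtain u where u: "0 \<le> u" "u \<le> 1" "x = (1 - u) * a + u * c" "y = (1 - u) * b + u * d"
    by (auto simp: in_segment)
  have "u * (c - a) = u * (d - b)"
    using assms by simp
  then show "x - a = y - b \<and> x \<in> closed_segment a c"
    using u by (auto simp: in_segment algebra_simps)
next
  assume "x - a = y - b \<and> x \<in> closed_segment a c"
  then obtain u where u: "0 \<le> u" "u \<le> 1" "x = (1 - u) * a + u * c" and xy: "x - a = y - b"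
    by (auto simp: in_segment)
  have "u * (c - a) = u * (d - b)"
    using assms by simp
  then have "y = (1 - u) * b + u * d"
    using u xy by (auto simp: algebra_simps)
  then show "(x, y) \<in> closed_segment (a, b) (c, d)"
    using u by (auto simp: in_segment)
qed

lemma mem_closed_segment_antidiagonal:
  fixes a b c d x y :: real
  assumes "c - a = b - d"
  shows "(x, y) \<in> closed_segment (a, b) (c, d) \<longleftrightarrow> x - a = b - y \<and> x \<in> closed_segment a c"
proof -
  \<comment> \<open>Negating the second coordinate turns an antidiagonal into a diagonal.\<close>
  have "(x, y) \<in> closed_segment (a, b) (c, d) \<longleftrightarrow> (x, - y) \<in> closed_segment (a, - b) (c, - d)"
    by (auto simp: in_segment algebra_simps; metis)
  also have "\<dots> \<longleftrightarrow> x - a = b - y \<and> x \<in> closed_segment a c"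
    using assms by (subst mem_closed_segment_diagonal) auto
  finally show ?thesis .
qed

lemma mem_polygon_boundary_octagon:
  assumes "n \<ge> 2"
  shows "(x, y) \<in> polygon_boundary (octagon n) \<longleftrightarrow>
           closed_silhouette (2 ^ n) x y \<and> \<not> silhouette (2 ^ n) x y"
proof -
  define h :: real where "h = 2 ^ (n - 2)"
  have h: "h > 0"
    by (simp add: h_def)
  obtain m where m: "n = m + 2"
    using assms by (metis add.commute le_Suc_ex)
  have pow: "2 ^ n = 4 * h" "2 ^ (n - 1) = 2 * h" "2 ^ (n - 2) = h"
    by (simp_all add: h_def m)
  have oct: "octagon n = [(0, 0), (4 * h, - (4 * h)), (6 * h, - (2 * h)), (5 * h, - h), (6 * h, 0),
      (5 * h, h), (6 * h, 2 * h), (4 * h, 4 * h)]"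
    unfolding octagon_def pow by simp
  \<comment> \<open>One disjunct for each edge, in the cyclic order of the vertices in
    \<open>octagon\<close>.\<close>
  have "(x, y) \<in> polygon_boundary (octagon n) \<longleftrightarrow>
      (x = - y \<and> 0 \<le> x \<and> x \<le> 4 * h) \<or> (x - y = 8 * h \<and> 4 * h \<le> x \<and> x \<le> 6 * h) \<or>
      (x + y = 4 * h \<and> 5 * h \<le> x \<and> x \<le> 6 * h) \<or> (x - y = 6 * h \<and> 5 * h \<le> x \<and> x \<le> 6 * h) \<or>
      (x + y = 6 * h \<and> 5 * h \<le> x \<and> x \<le> 6 * h) \<or> (x - y = 4 * h \<and> 5 * h \<le> x \<and> x \<le> 6 * h) \<or>
      (x + y = 8 * h \<and> 4 * h \<le> x \<and> x \<le> 6 * h) \<or> (x = y \<and> 0 \<le> x \<and> x \<le> 4 * h)"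
    using h unfolding polygon_boundary_def oct
    by (simp add: mem_closed_segment_diagonal mem_closed_segment_antidiagonal
        closed_segment_eq_real_ivl) argo
  also have "\<dots> \<longleftrightarrow> closed_silhouette (4 * h) x y \<and> \<not> silhouette (4 * h) x y"
    using h unfolding closed_silhouette_def silhouette_def by (smt (verit))
  finally show ?thesis
    by (simp add: pow)
qed

text \<open>A component starting in the open octagon \<open>U\<close> cannot cross
  \<open>frontier U\<close>, which is part of the boundary \<open>B\<close>, so it stays in a
  bounded set. A point off the closed octagon \<open>F\<close> instead lies on an unbounded ray that
  avoids \<open>F\<close>, so its component is unbounded.\<close>

lemma inside_octagon:
  assumes "n \<ge> 2"
  shows "(x, y) \<in> inside (polygon_boundary (octagon n)) \<longleftrightarrow> silhouette (2 ^ n) x y"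
proof -
  define K :: real where "K = 2 ^ n"
  define B where "B = polygon_boundary (octagon n)"
  define U where "U = {(x, y). silhouette K x y}"
  define F where "F = {(x, y). closed_silhouette K x y}"
  have K: "K > 0"
    by (simp add: K_def)
  have B: "B = F - U"
    using mem_polygon_boundary_octagon[OF assms] by (auto simp: B_def F_def U_def K_def)
  have "U \<subseteq> F"
    by (auto simp: U_def F_def silhouette_def closed_silhouette_def)
  have "open U"
    unfolding U_def silhouette_def case_prod_unfold
    by (intro open_Collect_conj open_Collect_disj open_Collect_less continuous_intros)
  have "closed F"
    unfolding F_def closed_silhouette_def case_prod_unfold
    by (intro closed_Collect_conj closed_Collect_disj closed_Collect_le continuous_intros)
  have "F \<subseteq> {0..2 * K} \<times> {- (2 * K)..2 * K}"
    by (auto simp: F_def closed_silhouette_def)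
  then have "bounded F"
    by (rule bounded_subset[OF bounded_Times[OF bounded_closed_interval bounded_closed_interval]])
  have "frontier U \<subseteq> B"
    using closure_minimal[OF \<open>U \<subseteq> F\<close> \<open>closed F\<close>] interior_open[OF \<open>open U\<close>]
    by (auto simp: frontier_def B)
  show ?thesis
  proof (cases "(x, y) \<in> U")
    case True
    let ?C = "connected_component_set (- B) (x, y)"
    have "(x, y) \<in> ?C"
      using True by (simp add: B connected_component_refl_eq)
    moreover have "?C \<inter> frontier U = {}"
      using \<open>frontier U \<subseteq> B\<close> connected_component_subset by blast
    ultimately have "?C \<subseteq> U"
      using connected_Int_frontier[OF connected_connected_component, of "- B" "(x, y)" U] True
      by blast
    then have "bounded ?C"
      using \<open>bounded F\<close> \<open>U \<subseteq> F\<close> bounded_subset by blast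
    then show ?thesis
      using True by (auto simp: inside_def B_def[symmetric] U_def K_def B)
  next
    case False
    txt \<open>The closed octagon is star-shaped about \<open>(K, 0)\<close>, so the ray from there through a point
      outside it never enters it again.\<close>
    have "(x, y) \<notin> inside B"
    proof
      assume "(x, y) \<in> inside B"
      then have notB: "(x, y) \<notin> B" and bd: "bounded (connected_component_set (- B) (x, y))"
        by (auto simp: inside_def)
      then have notF: "(x, y) \<notin> F"
        using False B by blast
      define ray where "ray t = (K + t * (x - K), t * y)" for t
      have rayF: "ray t \<notin> F" if "t \<ge> 1" for t
      proof
        assume rF: "ray t \<in> F"
        define s where "s = inverse t"
        have s: "0 < s" "s \<le> 1" "s * t = 1"
          using that by (auto simp: s_def field_simps)
        define a where "a = K + t * (x - K)"
        \<comment> \<open>With \<open>s = 1 / t\<close>, the point \<open>(x, y)\<close> is a convex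
          combination of the centre \<open>(K, 0)\<close> and the ray point
          \<open>(a, b)\<close>.\<close>
        have x: "x = (1 - s) * K + s * a"
        proof -
          have "s * a = s * K + (s * t) * (x - K)"
            by (simp add: a_def algebra_simps)
          then show ?thesis
            using s by (simp add: algebra_simps)
        qed
        define b where "b = t * y"
        have y: "\<bar>y\<bar> = s * \<bar>b\<bar>"
          using s that by (simp add: b_def abs_mult flip: mult.assoc)
        have ab: "closed_silhouette K a b"
          using rF by (simp add: ray_def F_def a_def b_def)
        have sK: "(1 - s) * K \<ge> 0"
          using s K by simp
        have m: "s * u \<le> s * v" if "u \<le> v" for u v
          using that s by simp
        have "\<bar>y\<bar> \<le> x"
          using ab m[of "\<bar>b\<bar>" a] sK by (simp add: closed_silhouette_def x y)
        moreover have "x + \<bar>y\<bar> \<le> 2 * K"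
          using ab m[of "a + \<bar>b\<bar>" "2 * K"] sK by (simp add: closed_silhouette_def x y algebra_simps)
        \<comment> \<open>The centre satisfies both alternatives, so whichever holds at
          \<open>(a, b)\<close> passes to \<open>(x, y)\<close>. This makes the octagon star-shaped
          although it is not convex.\<close>
        moreover have "x - \<bar>y\<bar> \<le> K \<or> 2 * (x + \<bar>y\<bar>) \<le> 3 * K"
          using ab m[of "a - \<bar>b\<bar>" "K"] m[of "2 * (a + \<bar>b\<bar>)" "3 * K"] sK
          by (auto simp: closed_silhouette_def x y algebra_simps)
        ultimately show False
          using notF by (simp add: F_def closed_silhouette_def)
      qed
      have "connected (ray ` {1..})"
        unfolding ray_def by (intro connected_continuous_image continuous_intros) auto
      moreover have "ray ` {1..} \<subseteq> - B"
        using rayF B by auto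
      moreover have "(x, y) \<in> ray ` {1..}"
        by (auto simp: ray_def image_iff intro!: bexI[of _ 1])
      ultimately have "ray ` {1..} \<subseteq> connected_component_set (- B) (x, y)"
        by (intro connected_component_maximal)
      then have "bounded (ray ` {1..})"
        using bd bounded_subset by blast
      then obtain M where M: "norm (ray t) \<le> M" if "t \<ge> 1" for t
        unfolding bounded_iff by auto
      have "(K, 0) \<in> F"
        using K by (simp add: F_def closed_silhouette_def)
      then have "0 < norm (x - K, y)"
        using notF by (auto simp: zero_prod_def)
      \<comment> \<open>The ray's direction vector is nonzero, so some multiple of it exceeds the
        supposed bound \<open>M\<close> even after moving the base point by
        \<open>K\<close>.\<close>
      then obtain N :: nat where N: "of_nat N * norm (x - K, y) > M + K"
        using reals_Archimedean3 by blast
      let ?t = "of_nat (Suc N) :: real"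
      have "?t * norm (x - K, y) = norm (?t *\<^sub>R (x - K, y))"
        by (simp only: norm_scaleR abs_of_nat)
      also have "?t *\<^sub>R (x - K, y) = ray ?t - (K, 0)"
        by (simp add: ray_def)
      also have "norm \<dots> \<le> norm (ray ?t) + norm (K, 0 :: real)"
        by (rule norm_triangle_ineq4)
      also have "\<dots> \<le> M + K"
        using M[of ?t] K by (simp add: norm_Pair)
      finally have "?t * norm (x - K, y) \<le> M + K" .
      moreover have "of_nat N * norm (x - K, y) \<le> ?t * norm (x - K, y)"
        by (intro mult_right_mono) auto
      ultimately show False
        using N by linarith
    qed
    then show ?thesis
      using False by (simp add: B_def U_def K_def)
  qed
qed

section \<open>Integer cells, contents and placement maps\<close>

lemma silhouette_of_int:
  "silhouette (of_int K :: real) (of_int i) (of_int j) \<longleftrightarrow> silhouette K i j"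
proof -
  have "silhouette (of_int K :: real) (of_int i) (of_int j) \<longleftrightarrow>
      real_of_int \<bar>j\<bar> < of_int i \<and> real_of_int (i + \<bar>j\<bar>) < of_int (2 * K) \<and>
      (real_of_int (i - \<bar>j\<bar>) < of_int K \<or> real_of_int (2 * (i + \<bar>j\<bar>)) < of_int (3 * K))"
    unfolding silhouette_def
    by (simp only: of_int_abs of_int_add of_int_diff of_int_mult of_int_numeral)
  then show ?thesis
    unfolding of_int_less_iff silhouette_def .
qed

lemma mem_stealth_region: "(i, j) \<in> stealth_region n \<longleftrightarrow> silhouette (2 ^ n) i j"
proof -
  consider "n = 0" | "n = 1" | "n \<ge> 2"
    by linarith
  then show ?thesis
  proof cases
    case 3
    then show ?thesis
      using silhouette_of_int[of "2 ^ n" i j] by (simp add: stealth_region_def inside_octagon)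
  qed (auto simp: stealth_region_def silhouette_def)
qed

text \<open>Extension by 0 to the whole plane lets configurations be overlaid by adding functions.
  Inside the octagon \<open>i\<close> is positive, so \<open>nat i\<close> loses nothing.\<close>

definition content :: "nat \<Rightarrow> int \<Rightarrow> int \<Rightarrow> int" where
  "content n i j = (if silhouette (2 ^ n) i j then R (nat i) j mod 2 else 0)"

lemma mem_stealth: "((i, j), v) \<in> stealth n \<longleftrightarrow> silhouette (2 ^ n) i j \<and> v = content n i j"
proof -
  have "\<exists>k. i = int k \<and> v = R k j mod 2" if "0 < i" "v = R (nat i) j mod 2"
    using that by (intro exI[of _ "nat i"]) auto
  then show ?thesis
    by (auto simp: stealth_def rhombus_mod2_def mem_stealth_region content_def silhouette_def)
qed

text \<open>The placement maps are inverted. The summand 1 appears because the tip in standard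
  position is \<open>(1, 0)\<close>, one row below the vertex at the origin.\<close>

lemma mem_grow:
  "((x, y), v) \<in> grow_down m (a, b) \<longleftrightarrow> ((1 + x - a, y - b), v) \<in> stealth m"
  "((x, y), v) \<in> grow_right m (a, b) \<longleftrightarrow> ((1 + y - b, a - x), v) \<in> stealth m"
  "((x, y), v) \<in> grow_left m (a, b) \<longleftrightarrow> ((1 + b - y, x - a), v) \<in> stealth m"
  "((x, y), v) \<in> grow_up m (a, b) \<longleftrightarrow> ((1 + a - x, b - y), v) \<in> stealth m"
proof -
  have conv: "x = a + i \<longleftrightarrow> i = x - a" "x = a - i \<longleftrightarrow> i = a - x"
    "y = b + i \<longleftrightarrow> i = y - b" "y = b - i \<longleftrightarrow> i = b - y" for i
    by auto
  show "((x, y), v) \<in> grow_down m (a, b) \<longleftrightarrow> ((1 + x - a, y - b), v) \<in> stealth m"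
    "((x, y), v) \<in> grow_right m (a, b) \<longleftrightarrow> ((1 + y - b, a - x), v) \<in> stealth m"
    "((x, y), v) \<in> grow_left m (a, b) \<longleftrightarrow> ((1 + b - y, x - a), v) \<in> stealth m"
    "((x, y), v) \<in> grow_up m (a, b) \<longleftrightarrow> ((1 + a - x, b - y), v) \<in> stealth m"
    unfolding grow_down_def grow_right_def grow_left_def grow_up_def
    by (simp_all add: conv add_diff_eq)
qed

section \<open>Plus-shaped sums determine a configuration modulo 2\<close>

definition plus_sum :: "(int \<Rightarrow> int \<Rightarrow> int) \<Rightarrow> int \<Rightarrow> int \<Rightarrow> int" where
  "plus_sum f x y = f (x - 1) y + f x (y - 1) + f x y + f x (y + 1) + f (x + 1) y"

text \<open>The convex vertices of the octagon of order \<open>n\<close> for \<open>H = 2 ^ (n - 1)\<close>. At its two reflex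
  vertices the plus-shaped sums are even.\<close>

definition corners :: "int \<Rightarrow> int \<Rightarrow> int \<Rightarrow> int" where
  "corners H x y =
     of_bool (x = 0 \<and> y = 0) + of_bool (x = 2 * H \<and> y = 2 * H) + of_bool (x = 2 * H \<and> y = - 2 * H)
     + of_bool (x = 3 * H \<and> y = H) + of_bool (x = 3 * H \<and> y = - H) + of_bool (x = 3 * H \<and> y = 0)"

lemma R_eq_0: "\<bar>k\<bar> \<ge> int n \<Longrightarrow> R n k = 0"
  by (induction n k rule: R.induct) auto

text \<open>The rule centred just above \<open>(k, j)\<close> expresses that entry through the two
  preceding rows, as the recursion of \<open>R\<close> does modulo 2. Going up one row and sideways
  by at most one column increases neither \<open>x + \<bar>y\<bar>\<close> nor
  \<open>x - \<bar>y\<bar>\<close>, so only the bound \<open>\<bar>y\<bar> < x\<close> can fail.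
  Both sides vanish there, hence the second alternative of the claim.\<close>

lemma even_diff_R:
  assumes H: "H \<ge> 1"
    and supp: "\<And>x y. \<not> silhouette (2 * H) x y \<Longrightarrow> t x y = 0"
    and plus: "\<And>x y. even (plus_sum t x y + corners H x y)"
  shows "silhouette (2 * H) (int k) j \<or> \<bar>j\<bar> \<ge> int k \<Longrightarrow> even (t (int k) j - R k j)"
proof (induction k arbitrary: j rule: less_induct)
  case (less k)
  consider "\<bar>j\<bar> \<ge> int k" | "k = 1" "j = 0" | l where "k = Suc (Suc l)" "silhouette (2 * H) (int k) j"
    using less.prems
    by (cases k rule: R.cases[of "(k, j)" for k]) (auto simp: silhouette_def)
  then show ?case
  proof cases
    case 1
    then have "\<not> silhouette (2 * H) (int k) j"
      by (simp add: silhouette_def)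
    then show ?thesis
      using 1 by (simp add: supp R_eq_0)
  next
    case 2
    \<comment> \<open>The rule at the origin, where \<open>corners\<close> is 1, makes the entry at
      \<open>(1, 0)\<close> odd: it is the only cell of that plus that can be nonzero.\<close>
    have "t 0 0 = 0" "t (- 1) 0 = 0" "t 0 (- 1) = 0" "t 0 1 = 0"
      by (auto intro!: supp simp: silhouette_def)
    then show ?thesis
      using plus[of 0 0] H 2 by (simp add: plus_sum_def corners_def)
  next
    case 3
    have s: "\<bar>j\<bar> < int l + 2" "int l + 2 + \<bar>j\<bar> < 4 * H"
        "int l + 2 - \<bar>j\<bar> < 2 * H \<or> int l + 2 + \<bar>j\<bar> < 3 * H"
      using 3 by (auto simp: silhouette_def)
    \<comment> \<open>Directly below a convex vertex other than the origin one is outside the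
      octagon, and row \<open>l + 1\<close> is not row 0.\<close>
    have "corners H (int l + 1) j = 0"
      using s by (auto simp: corners_def of_bool_def)
    then have "even (t (int l) j + t (int l + 1) (j - 1) + t (int l + 1) j + t (int l + 1) (j + 1)
        + t (int l + 2) j)"
      using plus[of "int l + 1" j] by (simp add: plus_sum_def add.commute)
    moreover have "even (t (int l) j - R l j)"
      using s by (intro less.IH) (auto simp: 3 silhouette_def)
    moreover have "even (t (int (Suc l)) i - R (Suc l) i)" if "\<bar>i - j\<bar> \<le> 1" for i
    proof (rule less.IH)
      show "silhouette (2 * H) (int (Suc l)) i \<or> \<bar>i\<bar> \<ge> int (Suc l)"
        using s that unfolding silhouette_def by (smt (verit) of_nat_Suc)
    qed (simp add: 3)
    from this[of "j - 1"] this[of j] this[of "j + 1"]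
    have "even (t (int l + 1) (j - 1) - R (Suc l) (j - 1))"
      "even (t (int l + 1) j - R (Suc l) j)" "even (t (int l + 1) (j + 1) - R (Suc l) (j + 1))"
      by (auto simp: add.commute)
    moreover have "int k = int l + 2"
      using 3 by simp
    ultimately show ?thesis
      using 3(1) by (simp only: R.simps) presburger
  qed
qed

section \<open>Overlaying the five pieces\<close>

text \<open>The overlay of the five pieces of order \<open>m = n - 1\<close> and \<open>k = n - 2\<close>, for \<open>h = 2 ^ (n - 2)\<close>.\<close>

definition pieces :: "nat \<Rightarrow> nat \<Rightarrow> int \<Rightarrow> int \<Rightarrow> int \<Rightarrow> int" where
  "pieces m k h x y = content m x y + content m (y + 4 * h) (4 * h - x)
     + content m (4 * h - y) (x - 4 * h) + content k (x - 3 * h) y + content k (6 * h - x) (- y)"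

text \<open>Vertices cancel in pairs between two pieces or between a piece and the big octagon. Body
  and tail enter through their joint sum only, so that order 0 is covered too.\<close>

lemma even_plus_sum_pieces:
  assumes m: "\<And>x y. even (plus_sum (content m) x y + corners h x y)"
    and k: "even (plus_sum (content k) (x - 3 * h) y + plus_sum (content k) (6 * h - x) (- y)
      + of_bool (x = 3 * h \<and> y = 0) + of_bool (x = 4 * h \<and> y = h) + of_bool (x = 4 * h \<and> y = - h)
      + of_bool (x = 6 * h \<and> y = 0) + of_bool (x = 5 * h \<and> y = h) + of_bool (x = 5 * h \<and> y = - h))"
  shows "even (plus_sum (pieces m k h) x y + corners (2 * h) x y)"
proof -
  \<comment> \<open>The plus shape is invariant under quarter turns, so its sums commute with every
    placement map.\<close>
  have split: "plus_sum (pieces m k h) x y = plus_sum (content m) x y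
      + plus_sum (content m) (y + 4 * h) (4 * h - x) + plus_sum (content m) (4 * h - y) (x - 4 * h)
      + plus_sum (content k) (x - 3 * h) y + plus_sum (content k) (6 * h - x) (- y)"
    by (simp add: plus_sum_def pieces_def algebra_simps minus_diff_commute)
  \<comment> \<open>The vertices are listed in the order of \<open>corners\<close>, so the two sides
    can be compared term by term.\<close>
  have left: "corners h (y + 4 * h) (4 * h - x) =
      of_bool (x = 4 * h \<and> y = - 4 * h) + of_bool (x = 2 * h \<and> y = - 2 * h)
      + of_bool (x = 6 * h \<and> y = - 2 * h) + of_bool (x = 3 * h \<and> y = - h)
      + of_bool (x = 5 * h \<and> y = - h) + of_bool (x = 4 * h \<and> y = - h)"
    unfolding corners_def
    by (intro arg_cong2[where f = "(+)"] arg_cong[where f = of_bool]) auto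
  have right: "corners h (4 * h - y) (x - 4 * h) =
      of_bool (x = 4 * h \<and> y = 4 * h) + of_bool (x = 6 * h \<and> y = 2 * h)
      + of_bool (x = 2 * h \<and> y = 2 * h) + of_bool (x = 5 * h \<and> y = h)
      + of_bool (x = 3 * h \<and> y = h) + of_bool (x = 4 * h \<and> y = h)"
    unfolding corners_def
    by (intro arg_cong2[where f = "(+)"] arg_cong[where f = of_bool]) auto
  have double: "corners (2 * h) x y =
      of_bool (x = 0 \<and> y = 0) + of_bool (x = 4 * h \<and> y = 4 * h) + of_bool (x = 4 * h \<and> y = - 4 * h)
      + of_bool (x = 6 * h \<and> y = 2 * h) + of_bool (x = 6 * h \<and> y = - 2 * h)
      + of_bool (x = 6 * h \<and> y = 0)"
    unfolding corners_def by simp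
  \<comment> \<open>Each point occurs exactly twice on the left: \<open>(2 * h, 2 * h)\<close>, for
    instance, comes from nose and right wing, and \<open>(6 * h, 0)\<close> from the tail and the
    big octagon.\<close>
  have sum_eq: "corners h x y + corners h (y + 4 * h) (4 * h - x) + corners h (4 * h - y) (x - 4 * h)
      + corners (2 * h) x y + (of_bool (x = 3 * h \<and> y = 0) + of_bool (x = 4 * h \<and> y = h)
      + of_bool (x = 4 * h \<and> y = - h) + of_bool (x = 6 * h \<and> y = 0) + of_bool (x = 5 * h \<and> y = h)
      + of_bool (x = 5 * h \<and> y = - h)) =
      2 * (of_bool (x = 0 \<and> y = 0) + of_bool (x = 2 * h \<and> y = 2 * h)
      + of_bool (x = 2 * h \<and> y = - 2 * h) + of_bool (x = 3 * h \<and> y = h)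
      + of_bool (x = 3 * h \<and> y = - h) + of_bool (x = 3 * h \<and> y = 0)
      + of_bool (x = 4 * h \<and> y = - 4 * h) + of_bool (x = 6 * h \<and> y = - 2 * h)
      + of_bool (x = 5 * h \<and> y = - h) + of_bool (x = 4 * h \<and> y = - h)
      + of_bool (x = 4 * h \<and> y = 4 * h) + of_bool (x = 6 * h \<and> y = 2 * h)
      + of_bool (x = 5 * h \<and> y = h) + of_bool (x = 4 * h \<and> y = h) + of_bool (x = 6 * h \<and> y = 0))"
    unfolding left right double unfolding corners_def by (simp add: algebra_simps)
  have parity: "even (a + b + c + d + e + w)"
    if "even (a + p)" "even (b + q)" "even (c + r)" "even (d + e + z)" "p + q + r + w + z = 2 * s"
    for a b c d e w p q r z s :: int
    using that by presburger
  show ?thesis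
    unfolding split
    by (rule parity[OF m m m _ sum_eq]) (use k in \<open>simp only: add.assoc\<close>)
qed

lemma silhouette_pieces:
  fixes h x y :: int
  shows "silhouette (2 * h) x y \<Longrightarrow> silhouette (4 * h) x y"
    "silhouette (2 * h) (y + 4 * h) (4 * h - x) \<Longrightarrow> silhouette (4 * h) x y"
    "silhouette (2 * h) (4 * h - y) (x - 4 * h) \<Longrightarrow> silhouette (4 * h) x y"
    "silhouette h (x - 3 * h) y \<Longrightarrow> silhouette (4 * h) x y"
    "silhouette h (6 * h - x) (- y) \<Longrightarrow> silhouette (4 * h) x y"
  unfolding silhouette_def by (smt (verit))+

lemma silhouette_disjoint:
  fixes h x y :: int
  shows "\<not> (silhouette (2 * h) x y \<and> silhouette (2 * h) (y + 4 * h) (4 * h - x))"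
    "\<not> (silhouette (2 * h) x y \<and> silhouette (2 * h) (4 * h - y) (x - 4 * h))"
    "\<not> (silhouette (2 * h) x y \<and> silhouette h (x - 3 * h) y)"
    "\<not> (silhouette (2 * h) x y \<and> silhouette h (6 * h - x) (- y))"
    "\<not> (silhouette (2 * h) (y + 4 * h) (4 * h - x) \<and> silhouette (2 * h) (4 * h - y) (x - 4 * h))"
    "\<not> (silhouette (2 * h) (y + 4 * h) (4 * h - x) \<and> silhouette h (x - 3 * h) y)"
    "\<not> (silhouette (2 * h) (y + 4 * h) (4 * h - x) \<and> silhouette h (6 * h - x) (- y))"
    "\<not> (silhouette (2 * h) (4 * h - y) (x - 4 * h) \<and> silhouette h (x - 3 * h) y)"
    "\<not> (silhouette (2 * h) (4 * h - y) (x - 4 * h) \<and> silhouette h (6 * h - x) (- y))"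
    "\<not> (silhouette h (x - 3 * h) y \<and> silhouette h (6 * h - x) (- y))"
  unfolding silhouette_def by (smt (z3))+

text \<open>The overlay plays the role of \<open>t\<close> in \<open>even_diff_R\<close>, with
  \<open>H = 2 * 2 ^ k\<close>, half the size parameter of the octagon of order
  \<open>k + 2\<close>.\<close>

lemma even_pieces_diff_content:
  assumes plus: "\<And>x y. even (plus_sum (pieces (Suc k) k (2 ^ k)) x y + corners (2 * 2 ^ k) x y)"
  shows "even (pieces (Suc k) k (2 ^ k) x y - content (Suc (Suc k)) x y)"
proof -
  have supp: "pieces (Suc k) k (2 ^ k) x y = 0" if "\<not> silhouette (2 * (2 * 2 ^ k)) x y" for x y
    using that silhouette_pieces[where h = "2 ^ k" and x = x and y = y]
    by (auto simp: pieces_def content_def)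
  show ?thesis
  proof (cases "silhouette (2 * (2 * 2 ^ k)) x y")
    case True
    have H: "(1 :: int) \<le> 2 * 2 ^ k"
      using zero_less_power[of "2 :: int" k] by linarith
    have "int (nat x) = x"
      using True by (auto simp: silhouette_def)
    then have "even (pieces (Suc k) k (2 ^ k) x y - R (nat x) y)"
      using even_diff_R[OF H supp plus, of "nat x" y] True by simp
    then show ?thesis
      using True by (simp add: content_def)
  next
    case False
    then show ?thesis
      by (simp add: supp) (simp add: content_def)
  qed
qed

section \<open>Small orders and induction for the vertex rule\<close>

lemma content_0: "content 0 x y = of_bool (x = 1 \<and> y = 0)"
  by (auto simp: content_def silhouette_def)

lemma content_1: "content (Suc 0) x y = of_bool (x = 1 \<and> y = 0) + of_bool (x = 2 \<and> y = - 1)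
    + of_bool (x = 2 \<and> y = 0) + of_bool (x = 2 \<and> y = 1)"
proof -
  have "silhouette (2 ^ Suc 0) x y \<longleftrightarrow> x = 1 \<and> y = 0 \<or> x = 2 \<and> (y = - 1 \<or> y = 0 \<or> y = 1)"
    by (auto simp: silhouette_def)
  then show ?thesis
    by (auto simp: content_def numeral_2_eq_2)
qed

lemma plus_sum_cong_mod2:
  assumes "\<And>x y. even (f x y - g x y)"
  shows "even (plus_sum f x y - plus_sum g x y)"
  using assms[of "x - 1" y] assms[of x "y - 1"] assms[of x y] assms[of x "y + 1"] assms[of "x + 1" y]
  unfolding plus_sum_def by presburger

lemma even_plus_sum_content_1: "even (plus_sum (content (Suc 0)) x y + corners 1 x y)"
proof -
  \<comment> \<open>Each group is the four-cell configuration seen from one arm or the centre of the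
    plus. Points other than the six in \<open>corners 1\<close> occur two or four times.\<close>
  have "plus_sum (content (Suc 0)) x y =
      (of_bool (x = 2 \<and> y = 0) + of_bool (x = 3 \<and> y = - 1) + of_bool (x = 3 \<and> y = 0)
        + of_bool (x = 3 \<and> y = 1))
      + (of_bool (x = 1 \<and> y = 1) + of_bool (x = 2 \<and> y = 0) + of_bool (x = 2 \<and> y = 1)
        + of_bool (x = 2 \<and> y = 2))
      + (of_bool (x = 1 \<and> y = 0) + of_bool (x = 2 \<and> y = - 1) + of_bool (x = 2 \<and> y = 0)
        + of_bool (x = 2 \<and> y = 1))
      + (of_bool (x = 1 \<and> y = - 1) + of_bool (x = 2 \<and> y = - 2) + of_bool (x = 2 \<and> y = - 1)
        + of_bool (x = 2 \<and> y = 0))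
      + (of_bool (x = 0 \<and> y = 0) + of_bool (x = 1 \<and> y = - 1) + of_bool (x = 1 \<and> y = 0)
        + of_bool (x = 1 \<and> y = 1))"
    unfolding plus_sum_def content_1
    by (intro arg_cong2[where f = "(+)"] arg_cong[where f = of_bool]) auto
  then show ?thesis
    unfolding corners_def by simp
qed

text \<open>For \<open>k = 0\<close> the body and the tail do not obey the vertex rule separately, because some of
  their vertices would not be cells, but these vertices are common to both and cancel.\<close>

lemma even_plus_sum_body_tail:
  fixes x y :: int
  assumes IH: "\<And>l x y. k = Suc l \<Longrightarrow> even (plus_sum (content k) x y + corners (2 ^ l) x y)"
  defines "h \<equiv> 2 ^ k"
  shows "even (plus_sum (content k) (x - 3 * h) y + plus_sum (content k) (6 * h - x) (- y)
    + of_bool (x = 3 * h \<and> y = 0) + of_bool (x = 4 * h \<and> y = h) + of_bool (x = 4 * h \<and> y = - h)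
    + of_bool (x = 6 * h \<and> y = 0) + of_bool (x = 5 * h \<and> y = h) + of_bool (x = 5 * h \<and> y = - h))"
proof (cases k)
  case 0
  \<comment> \<open>Body and tail are the adjacent cells \<open>(4, 0)\<close> and
    \<open>(5, 0)\<close>. Their pluses share exactly these two cells; the other six are the listed
    vertices.\<close>
  have "plus_sum (content 0) (x - 3) y = of_bool (x = 5 \<and> y = 0) + of_bool (x = 4 \<and> y = 1)
      + of_bool (x = 4 \<and> y = 0) + of_bool (x = 4 \<and> y = - 1) + of_bool (x = 3 \<and> y = 0)"
    unfolding plus_sum_def content_0
    by (intro arg_cong2[where f = "(+)"] arg_cong[where f = of_bool]) auto
  moreover have "plus_sum (content 0) (6 - x) (- y) = of_bool (x = 4 \<and> y = 0)
      + of_bool (x = 5 \<and> y = - 1) + of_bool (x = 5 \<and> y = 0) + of_bool (x = 5 \<and> y = 1)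
      + of_bool (x = 6 \<and> y = 0)"
    unfolding plus_sum_def content_0
    by (intro arg_cong2[where f = "(+)"] arg_cong[where f = of_bool]) auto
  ultimately show ?thesis
    by (simp add: h_def 0)
next
  case (Suc l)
  define g :: int where "g = 2 ^ l"
  have h: "h = 2 * g"
    by (simp add: h_def g_def Suc)
  have plus: "even (plus_sum (content k) x y + corners g x y)" for x y
    using IH[OF Suc] by (simp add: g_def)
  \<comment> \<open>Body and tail face each other across row \<open>9 * g\<close>, halfway between
    \<open>3 * h\<close> and \<open>6 * h\<close>, where three vertices of each coincide.\<close>
  have main: "corners g (x - 3 * h) y =
      of_bool (x = 3 * h \<and> y = 0) + of_bool (x = 4 * h \<and> y = h) + of_bool (x = 4 * h \<and> y = - h)
      + of_bool (x = 9 * g \<and> y = g) + of_bool (x = 9 * g \<and> y = - g) + of_bool (x = 9 * g \<and> y = 0)"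
    unfolding corners_def h
    by (intro arg_cong2[where f = "(+)"] arg_cong[where f = of_bool]) auto
  have tail: "corners g (6 * h - x) (- y) =
      of_bool (x = 6 * h \<and> y = 0) + of_bool (x = 5 * h \<and> y = - h) + of_bool (x = 5 * h \<and> y = h)
      + of_bool (x = 9 * g \<and> y = - g) + of_bool (x = 9 * g \<and> y = g) + of_bool (x = 9 * g \<and> y = 0)"
    unfolding corners_def h
    by (intro arg_cong2[where f = "(+)"] arg_cong[where f = of_bool]) auto
  have parity: "even (p + q + a + b + c + d + e + f)"
    if "even (p + m)" "even (q + t)" "m + t + (a + b + c + d + e + f) = 2 * s"
    for p q m t a b c d e f s :: int
  proof -
    have "p + q + a + b + c + d + e + f = (p + m) + (q + t) + 2 * (s - m - t)"
      using that(3) by simp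
    also have "even \<dots>"
      by (rule dvd_add[OF dvd_add[OF that(1,2)] dvd_triv_left])
    finally show ?thesis .
  qed
  show ?thesis
  proof (rule parity[OF plus plus])
    show "corners g (x - 3 * h) y + corners g (6 * h - x) (- y)
        + (of_bool (x = 3 * h \<and> y = 0) + of_bool (x = 4 * h \<and> y = h)
        + of_bool (x = 4 * h \<and> y = - h) + of_bool (x = 6 * h \<and> y = 0)
        + of_bool (x = 5 * h \<and> y = h) + of_bool (x = 5 * h \<and> y = - h)) =
        2 * (of_bool (x = 3 * h \<and> y = 0) + of_bool (x = 4 * h \<and> y = h)
        + of_bool (x = 4 * h \<and> y = - h) + of_bool (x = 6 * h \<and> y = 0)
        + of_bool (x = 5 * h \<and> y = h) + of_bool (x = 5 * h \<and> y = - h)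
        + of_bool (x = 9 * g \<and> y = g) + of_bool (x = 9 * g \<and> y = - g)
        + of_bool (x = 9 * g \<and> y = 0))"
      unfolding main tail by (simp add: algebra_simps)
  qed
qed

lemma even_plus_sum_pieces_double:
  assumes "\<And>l x y. l \<le> k \<Longrightarrow> even (plus_sum (content (Suc l)) x y + corners (2 ^ l) x y)"
  shows "even (plus_sum (pieces (Suc k) k (2 ^ k)) x y + corners (2 * 2 ^ k) x y)"
proof (rule even_plus_sum_pieces[OF _ even_plus_sum_body_tail])
  show "even (plus_sum (content (Suc k)) x y + corners (2 ^ k) x y)" for x y
    by (rule assms) (rule order_refl)
  show "even (plus_sum (content k) x y + corners (2 ^ l) x y)" if "k = Suc l" for l x y
    unfolding that by (rule assms) (simp add: that)
qed

text \<open>By strong induction the overlay of smaller pieces obeys the rule for the next order;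
  being then congruent to the true contents, it passes the rule on to them.\<close>

lemma even_plus_sum_content: "even (plus_sum (content (Suc m)) x y + corners (2 ^ m) x y)"
proof (induction m arbitrary: x y rule: less_induct)
  case (less m)
  show ?case
  proof (cases m)
    case 0
    then show ?thesis
      using even_plus_sum_content_1 by simp
  next
    case (Suc k)
    have "even (plus_sum (content (Suc l)) x y + corners (2 ^ l) x y)" if "l \<le> k" for l x y
      by (rule less.IH) (simp add: Suc less_Suc_eq_le that)
    note pieces = even_plus_sum_pieces_double[OF this]
    have "even (p - c) \<Longrightarrow> even (p + d) \<Longrightarrow> even (c + d)" for p c d :: int
      by presburger
    from this[OF plus_sum_cong_mod2[OF even_pieces_diff_content[OF pieces]] pieces]
    show ?thesis
      by (simp only: Suc power_Suc)
  qed
qed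

lemma even_pieces_diff_content_double:
  "even (pieces (Suc k) k (2 ^ k) x y - content (Suc (Suc k)) x y)"
  by (rule even_pieces_diff_content[OF even_plus_sum_pieces_double[OF even_plus_sum_content]])

section \<open>Assembling the decomposition\<close>

lemma cells_eq:
  assumes "\<And>x y v. ((x, y), v) \<in> P \<longleftrightarrow> Q x y \<and> v = f x y"
  shows "cells P = {(x, y). Q x y}"
proof -
  have "c \<in> cells P \<longleftrightarrow> (\<exists>v. (c, v) \<in> P)" for c
    by (force simp: cells_def)
  then show ?thesis
    using assms by auto
qed

theorem theorem1:
  fixes n :: nat
  assumes "n \<ge> 2"
  shows "decomposes_into (stealth n)
    [grow_down (n - 1) (1, 0),
     grow_right (n - 1) (2 ^ n, - (2 ^ n - 1)),
     grow_left (n - 1) (2 ^ n, 2 ^ n - 1),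
     grow_down (n - 2) (2 ^ n - 2 ^ (n - 2) + 1, 0),
     grow_up (n - 2) (2 ^ n + 2 ^ (n - 1) - 1, 0)]"
    (is "decomposes_into _ [?nose, ?left, ?right, ?body, ?tail]")
proof -
  obtain k where n: "n = Suc (Suc k)"
    using assms by (metis Suc_le_D numeral_2_eq_2 Suc_le_mono)
  define h :: int where "h = 2 ^ k"
  have h: "h \<ge> 1"
    by (simp add: h_def)
  have pow: "2 ^ n = 4 * h" "2 ^ (n - 1) = 2 * h" "2 ^ (n - 2) = h" "2 ^ Suc k = 2 * h" "2 ^ k = h"
    by (simp_all add: n h_def)
  note disjoint = silhouette_disjoint[where h = h]
  have S: "((x, y), v) \<in> stealth n \<longleftrightarrow> silhouette (4 * h) x y \<and> v = content n x y" for x y v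
    using mem_stealth[of x y v n] by (simp add: pow)
  have nose: "((x, y), v) \<in> ?nose \<longleftrightarrow> silhouette (2 * h) x y \<and> v = content (Suc k) x y" for x y v
    by (simp add: mem_grow mem_stealth n h_def)
  have left: "((x, y), v) \<in> ?left \<longleftrightarrow>
      silhouette (2 * h) (y + 4 * h) (4 * h - x) \<and> v = content (Suc k) (y + 4 * h) (4 * h - x)" for x y v
    by (simp add: mem_grow mem_stealth n h_def algebra_simps)
  have right: "((x, y), v) \<in> ?right \<longleftrightarrow>
      silhouette (2 * h) (4 * h - y) (x - 4 * h) \<and> v = content (Suc k) (4 * h - y) (x - 4 * h)" for x y v
    by (simp add: mem_grow mem_stealth n h_def algebra_simps)
  \<comment> \<open>The starting rows \<open>3 * h + 1\<close> and \<open>6 * h - 1\<close> of body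
    and tail are tips, so the vertices behind them are \<open>(3 * h, 0)\<close> and
    \<open>(6 * h, 0)\<close>.\<close>
  have body: "((x, y), v) \<in> ?body \<longleftrightarrow>
      silhouette h (x - 3 * h) y \<and> v = content k (x - 3 * h) y" for x y v
    by (simp add: mem_grow mem_stealth n h_def algebra_simps)
  have tail: "((x, y), v) \<in> ?tail \<longleftrightarrow>
      silhouette h (6 * h - x) (- y) \<and> v = content k (6 * h - x) (- y)" for x y v
    by (simp add: mem_grow mem_stealth n h_def algebra_simps)
  note cells = cells_eq[OF nose] cells_eq[OF left] cells_eq[OF right] cells_eq[OF body] cells_eq[OF tail]
  \<comment> \<open>Disjointness leaves at most one nonzero summand, so the overlay takes only the
    values 0 and 1 and congruence modulo 2 becomes equality.\<close>
  have content_eq: "content n x y = pieces (Suc k) k h x y" for x y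
  proof -
    have "pieces (Suc k) k h x y \<in> {0, 1}"
      using disjoint[where x = x and y = y] by (auto simp: pieces_def content_def pow)
    moreover have "content n x y \<in> {0, 1}"
      by (auto simp: content_def)
    moreover have "even (pieces (Suc k) k h x y - content n x y)"
      using even_pieces_diff_content_double[of k x y] by (simp add: n h_def)
    ultimately show ?thesis
      by auto
  qed
  \<comment> \<open>On the cells of one piece the other four summands of the overlay vanish, so its
    contents are those of the big configuration.\<close>
  have piece: "P \<subseteq> stealth n"
    if "\<And>x y v. ((x, y), v) \<in> P \<longleftrightarrow> Q x y \<and> v = f x y"
      "\<And>x y. Q x y \<Longrightarrow> silhouette (4 * h) x y \<and> pieces (Suc k) k h x y = f x y" for P Q f
    using that by (auto simp: S content_eq)
  have "?nose \<subseteq> stealth n"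
    by (rule piece[OF nose])
      (use disjoint silhouette_pieces(1) in \<open>auto simp: pieces_def content_def pow\<close>)
  moreover have "?left \<subseteq> stealth n"
    by (rule piece[OF left])
      (use disjoint silhouette_pieces(2) in \<open>auto simp: pieces_def content_def pow\<close>)
  moreover have "?right \<subseteq> stealth n"
    by (rule piece[OF right])
      (use disjoint silhouette_pieces(3) in \<open>auto simp: pieces_def content_def pow\<close>)
  moreover have "?body \<subseteq> stealth n"
    by (rule piece[OF body])
      (use disjoint silhouette_pieces(4) in \<open>auto simp: pieces_def content_def pow\<close>)
  moreover have "?tail \<subseteq> stealth n"
    by (rule piece[OF tail])
      (use disjoint silhouette_pieces(5) in \<open>auto simp: pieces_def content_def pow\<close>)
  \<comment> \<open>Off all five pieces every summand of the overlay is 0 by the convention in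
    \<open>content\<close>.\<close>
  moreover have "v = 0" if "((x, y), v) \<in> stealth n"
      "\<forall>P\<in>{?nose, ?left, ?right, ?body, ?tail}. (x, y) \<notin> cells P" for x y v
    using that unfolding S content_eq ball_simps cells by (simp add: pieces_def content_def pow)
  moreover have "disjoint_family_on (\<lambda>i. cells ([?nose, ?left, ?right, ?body, ?tail] ! i))
      {..<length [?nose, ?left, ?right, ?body, ?tail]}"
  proof -
    have "cells ?nose \<inter> cells ?left = {}" "cells ?nose \<inter> cells ?right = {}"
      "cells ?nose \<inter> cells ?body = {}" "cells ?nose \<inter> cells ?tail = {}"
      "cells ?left \<inter> cells ?right = {}" "cells ?left \<inter> cells ?body = {}"
      "cells ?left \<inter> cells ?tail = {}" "cells ?right \<inter> cells ?body = {}"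
      "cells ?right \<inter> cells ?tail = {}" "cells ?body \<inter> cells ?tail = {}"
      unfolding cells using disjoint by auto
    note inter = this this[THEN trans[OF Int_commute]]
    have "{..<length [?nose, ?left, ?right, ?body, ?tail]} = {0, 1, 2, 3, 4}"
      by auto
    then show ?thesis
      using inter unfolding disjoint_family_on_def by (simp del: list.size)
  qed
  ultimately show ?thesis
    by (auto simp: decomposes_into_def)
qed

end
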